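(* Let $(G,\cdot,\bullet)$ be a two-sided skew brace. For $x\in G$ let $x^{-1}$ denote the inverse of $x$ in $(G,\cdot)$ and $\overline{x}$ the inverse of $x$ in $(G,\bullet)$. Then $(G,\cdot,\star)$ is a group-rack, where $x\star y := x\bullet y\bullet\overline{x}$ for $x,y\in G$. Hence $(G,\diamond,\star)$ is a rack-pairing, where $x\diamond y := xyx^{-1}$ for $x,y\in G$.
   Context: Write $xy$ for $x\cdot y$. A (left) skew brace is a triple $(G,\cdot,\bullet)$ in which $(G,\cdot)$ and $(G,\bullet)$ are both groups and $x\bullet(yz) = (x\bullet y)x^{-1}(x\bullet z)$ for all $x,y,z\in G$. It is two-sided if in addition $(xy)\bullet z = (x\bullet z)z^{-1}(y\bullet z)$ for all $x,y,z\in G$. A (left) rack $(Q,\diamond)$ is a nonempty set with a binary operation such that $x\diamond(y\diamond z) = (x\diamond y)\diamond(x\diamond z)$ for all $x,y,z$, and for any $x,y$ there is a unique $c$ with $x\diamond c = y$. A group-rack is a triple $(G,\cdot,\star)$ in which $(G,\cdot)$ is a group, $(G,\star)$ is a rack, and $x\star(yz) = (x\star y)(x\star z)$ for all $x,y,z\in G$. A rack-pairing is a triple $(Q,\diamond,\star)$ such that $(Q,\diamond)$ and $(Q,\star)$ are racks and $x\star(y\diamond z) = (x\star y)\diamond(x\star z)$ for all $x,y,z\in Q$. *)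

theory Defs
  imports "HOL-Algebra.Group"
begin

text \<open>
  A skew brace is given by two group structures \<open>A\<close> (for \<open>\<cdot>\<close>) and \<open>B\<close> (for \<open>\<bullet>\<close>) on
  the same carrier. Each record carries its own unit; that the two units agree is a
  consequence of the axioms and is not assumed.
\<close>

locale skew_brace = A: group A + B: group B for A (structure) and B +
  assumes same_carrier: "carrier A = carrier B"
    and left_brace:
      "\<lbrakk>x \<in> carrier A; y \<in> carrier A; z \<in> carrier A\<rbrakk> \<Longrightarrow>
        x \<otimes>\<^bsub>B\<^esub> (y \<otimes>\<^bsub>A\<^esub> z) =
        (x \<otimes>\<^bsub>B\<^esub> y) \<otimes>\<^bsub>A\<^esub> inv\<^bsub>A\<^esub> x \<otimes>\<^bsub>A\<^esub> (x \<otimes>\<^bsub>B\<^esub> z)"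

locale two_sided_skew_brace = skew_brace A B for A (structure) and B +
  assumes right_brace:
      "\<lbrakk>x \<in> carrier A; y \<in> carrier A; z \<in> carrier A\<rbrakk> \<Longrightarrow>
        (x \<otimes>\<^bsub>A\<^esub> y) \<otimes>\<^bsub>B\<^esub> z =
        (x \<otimes>\<^bsub>B\<^esub> z) \<otimes>\<^bsub>A\<^esub> inv\<^bsub>A\<^esub> z \<otimes>\<^bsub>A\<^esub> (y \<otimes>\<^bsub>B\<^esub> z)"

locale rack =
  fixes Q :: "'a set" and dia :: "'a \<Rightarrow> 'a \<Rightarrow> 'a"  (infixl \<open>\<diamondop>\<close> 70)
  assumes nonempty: "Q \<noteq> {}"
    and dia_closed: "\<lbrakk>x \<in> Q; y \<in> Q\<rbrakk> \<Longrightarrow> x \<diamondop> y \<in> Q"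
    and self_distrib:
      "\<lbrakk>x \<in> Q; y \<in> Q; z \<in> Q\<rbrakk> \<Longrightarrow> x \<diamondop> (y \<diamondop> z) = (x \<diamondop> y) \<diamondop> (x \<diamondop> z)"
    and left_divisible: "\<lbrakk>x \<in> Q; y \<in> Q\<rbrakk> \<Longrightarrow> \<exists>!c. c \<in> Q \<and> x \<diamondop> c = y"

locale group_rack = group G + rack "carrier G" star
  for G (structure) and star  (infixl \<open>\<star>\<close> 70) +
  assumes star_mult_distrib:
      "\<lbrakk>x \<in> carrier G; y \<in> carrier G; z \<in> carrier G\<rbrakk> \<Longrightarrow>
        x \<star> (y \<otimes> z) = (x \<star> y) \<otimes> (x \<star> z)"

locale rack_pairing = D: rack Q dia + S: rack Q star
  for Q and dia (infixl \<open>\<diamondop>\<close> 70) and star (infixl \<open>\<star>\<close> 70) +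
  assumes star_dia_distrib:
      "\<lbrakk>x \<in> Q; y \<in> Q; z \<in> Q\<rbrakk> \<Longrightarrow> x \<star> (y \<diamondop> z) = (x \<star> y) \<diamondop> (x \<star> z)"

end

theory Submission
  imports Defs
begin

text \<open>
  Write \<open>w\<close> for the \<open>\<bullet>\<close>-inverse of \<open>x\<close>. Expanding \<open>x \<bullet> (yz) \<bullet> w\<close> with the left and then the
  right brace law gives \<open>(x \<bullet> y \<bullet> w) w\<inverse> (x\<inverse> \<bullet> w) w\<inverse> (x \<bullet> z \<bullet> w)\<close>. The right brace law applied to
  \<open>(x x\<inverse>) \<bullet> w\<close> shows \<open>x\<inverse> \<bullet> w = w w\<close>, so the middle factor cancels and conjugation by \<open>x\<close> in
  \<open>(G, \<bullet>)\<close> is an endomorphism of \<open>(G, \<cdot>)\<close>; in particular it preserves conjugation in \<open>(G, \<cdot>)\<close>.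
\<close>

lemma (in group)
  assumes "x \<in> carrier G" "y \<in> carrier G"
  shows inv_mult_cancel: "inv x \<otimes> (x \<otimes> y) = y"
    and mult_inv_cancel: "x \<otimes> (inv x \<otimes> y) = y"
  using assms by (simp_all flip: m_assoc)

text \<open>Needed for both group structures: in \<open>A\<close> it gives the rack \<diamondop>, in
  \<open>B\<close> the rack \<star>. Unique divisibility holds because conjugation by
  \<open>inv x\<close> undoes conjugation by \<open>x\<close>.\<close>

lemma (in group) rack_conjugation:
  "rack (carrier G) (\<lambda>x y. x \<otimes> y \<otimes> inv x)"
proof unfold_locales
  fix x y z assume "x \<in> carrier G" "y \<in> carrier G" "z \<in> carrier G"
  then show "x \<otimes> (y \<otimes> z \<otimes> inv y) \<otimes> inv x =
      (x \<otimes> y \<otimes> inv x) \<otimes> (x \<otimes> z \<otimes> inv x) \<otimes> inv (x \<otimes> y \<otimes> inv x)"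
    by (simp add: m_assoc inv_mult_group inv_mult_cancel)
next
  fix x y assume xy: "x \<in> carrier G" "y \<in> carrier G"
  show "\<exists>!c. c \<in> carrier G \<and> x \<otimes> c \<otimes> inv x = y"
  proof (rule ex1I[of _ "inv x \<otimes> y \<otimes> x"])
    show "inv x \<otimes> y \<otimes> x \<in> carrier G \<and> x \<otimes> (inv x \<otimes> y \<otimes> x) \<otimes> inv x = y"
      using xy by (simp add: m_assoc mult_inv_cancel)
  next
    fix c assume "c \<in> carrier G \<and> x \<otimes> c \<otimes> inv x = y"
    with xy show "c = inv x \<otimes> y \<otimes> x"
      by (auto simp: m_assoc inv_mult_cancel)
  qed
qed auto

text \<open>An endomorphism preserves products and inverses. Applied to \<bullet>-conjugation, this
  is the compatibility law of the rack-pairing.\<close>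

lemma (in group) hom_conjugation:
  assumes "h \<in> hom G G" "y \<in> carrier G" "z \<in> carrier G"
  shows "h (y \<otimes> z \<otimes> inv y) = h y \<otimes> h z \<otimes> inv (h y)"
proof -
  interpret group_hom G G h
    using assms(1) by unfold_locales
  show ?thesis
    using assms by simp
qed

text \<open>In the left brace law, taking the unit of \<open>B\<close> for \<open>x\<close> and the
  unit of \<open>A\<close> for \<open>y\<close> and \<open>z\<close> collapses the right side to the
  \<open>A\<close>-inverse of the unit of \<open>B\<close>, and the left side to the unit of
  \<open>A\<close>.\<close>

lemma (in skew_brace) one_eq: "\<one>\<^bsub>B\<^esub> = \<one>\<^bsub>A\<^esub>"
proof -
  have e: "\<one>\<^bsub>B\<^esub> \<in> carrier A"
    by (simp add: same_carrier)
  then have "inv\<^bsub>A\<^esub> \<one>\<^bsub>B\<^esub> = \<one>\<^bsub>A\<^esub>"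
    using left_brace[of "\<one>\<^bsub>B\<^esub>" "\<one>\<^bsub>A\<^esub>" "\<one>\<^bsub>A\<^esub>"] by (simp flip: same_carrier)
  with e show ?thesis
    by (metis A.inv_inv A.inv_one)
qed

lemma (in two_sided_skew_brace) conjugation_hom:
  assumes x: "x \<in> carrier A"
  shows "(\<lambda>y. x \<otimes>\<^bsub>B\<^esub> y \<otimes>\<^bsub>B\<^esub> inv\<^bsub>B\<^esub> x) \<in> hom A A"
proof (rule homI)
  have B_closed: "a \<otimes>\<^bsub>B\<^esub> b \<in> carrier A" if "a \<in> carrier A" "b \<in> carrier A" for a b
    using that by (simp add: same_carrier)
  define w where "w = inv\<^bsub>B\<^esub> x"
  have w: "w \<in> carrier A"
    using x by (simp add: w_def same_carrier)
  fix y assume y: "y \<in> carrier A"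
  show "x \<otimes>\<^bsub>B\<^esub> y \<otimes>\<^bsub>B\<^esub> inv\<^bsub>B\<^esub> x \<in> carrier A"
    using x y w unfolding w_def by (simp add: B_closed)
  fix z assume z: "z \<in> carrier A"
  \<comment> \<open>This is \<open>x\<inverse> \<bullet> w = w w\<close> with one \<open>w\<close>
    moved across. Both \<open>1 \<bullet> w = w\<close> and \<open>x \<bullet> w = 1\<close> rest on
    the agreement of the two units.\<close>
  have "w = inv\<^bsub>A\<^esub> w \<otimes>\<^bsub>A\<^esub> (inv\<^bsub>A\<^esub> x \<otimes>\<^bsub>B\<^esub> w)"
  proof -
    have "\<one>\<^bsub>A\<^esub> \<otimes>\<^bsub>B\<^esub> w = w"
      using w same_carrier by (simp flip: one_eq)
    moreover have "x \<otimes>\<^bsub>B\<^esub> w = \<one>\<^bsub>A\<^esub>"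
      using x same_carrier by (simp add: w_def flip: one_eq)
    ultimately show ?thesis
      using right_brace[of x "inv\<^bsub>A\<^esub> x" w] x w by simp
  qed
  then have cancel: "inv\<^bsub>A\<^esub> w \<otimes>\<^bsub>A\<^esub> (inv\<^bsub>A\<^esub> x \<otimes>\<^bsub>B\<^esub> w) \<otimes>\<^bsub>A\<^esub> inv\<^bsub>A\<^esub> w = \<one>\<^bsub>A\<^esub>"
    using w by simp
  \<comment> \<open>The left law produces three factors; two uses of the right law distribute
    \<open>\<bullet> w\<close> over them, leaving a \<open>w\<inverse>\<close> at each
    joint.\<close>
  have "x \<otimes>\<^bsub>B\<^esub> (y \<otimes>\<^bsub>A\<^esub> z) \<otimes>\<^bsub>B\<^esub> w =
      (x \<otimes>\<^bsub>B\<^esub> y \<otimes>\<^bsub>B\<^esub> w) \<otimes>\<^bsub>A\<^esub> (inv\<^bsub>A\<^esub> w \<otimes>\<^bsub>A\<^esub> (inv\<^bsub>A\<^esub> x \<otimes>\<^bsub>B\<^esub> w) \<otimes>\<^bsub>A\<^esub> inv\<^bsub>A\<^esub> w)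
        \<otimes>\<^bsub>A\<^esub> (x \<otimes>\<^bsub>B\<^esub> z \<otimes>\<^bsub>B\<^esub> w)"
    using x y z w by (simp add: left_brace right_brace B_closed A.m_assoc)
  also have "\<dots> = (x \<otimes>\<^bsub>B\<^esub> y \<otimes>\<^bsub>B\<^esub> w) \<otimes>\<^bsub>A\<^esub> (x \<otimes>\<^bsub>B\<^esub> z \<otimes>\<^bsub>B\<^esub> w)"
    using x y z w by (simp add: cancel B_closed)
  finally show "x \<otimes>\<^bsub>B\<^esub> (y \<otimes>\<^bsub>A\<^esub> z) \<otimes>\<^bsub>B\<^esub> inv\<^bsub>B\<^esub> x =
      (x \<otimes>\<^bsub>B\<^esub> y \<otimes>\<^bsub>B\<^esub> inv\<^bsub>B\<^esub> x) \<otimes>\<^bsub>A\<^esub> (x \<otimes>\<^bsub>B\<^esub> z \<otimes>\<^bsub>B\<^esub> inv\<^bsub>B\<^esub> x)"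
    by (simp only: w_def)
qed

theorem proposition4p15:
  fixes A :: "('a, 'b) monoid_scheme" and B :: "('a, 'c) monoid_scheme"
  assumes "two_sided_skew_brace A B"
  shows "group_rack A (\<lambda>x y. x \<otimes>\<^bsub>B\<^esub> y \<otimes>\<^bsub>B\<^esub> inv\<^bsub>B\<^esub> x) \<and>
    rack_pairing (carrier A)
      (\<lambda>x y. x \<otimes>\<^bsub>A\<^esub> y \<otimes>\<^bsub>A\<^esub> inv\<^bsub>A\<^esub> x)
      (\<lambda>x y. x \<otimes>\<^bsub>B\<^esub> y \<otimes>\<^bsub>B\<^esub> inv\<^bsub>B\<^esub> x)"
proof -
  interpret two_sided_skew_brace A B
    by (fact assms)
  \<comment> \<open>The rack axioms for \<star> come from the group \<open>B\<close> alone; the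
    brace laws enter through \<open>conjugation_hom\<close>.\<close>
  have star: "rack (carrier A) (\<lambda>x y. x \<otimes>\<^bsub>B\<^esub> y \<otimes>\<^bsub>B\<^esub> inv\<^bsub>B\<^esub> x)"
    using B.rack_conjugation by (simp only: same_carrier)
  show ?thesis
  proof
    show "group_rack A (\<lambda>x y. x \<otimes>\<^bsub>B\<^esub> y \<otimes>\<^bsub>B\<^esub> inv\<^bsub>B\<^esub> x)"
      by (intro group_rack.intro group_rack_axioms.intro A.group_axioms star
          hom_mult[OF conjugation_hom])
    show "rack_pairing (carrier A) (\<lambda>x y. x \<otimes>\<^bsub>A\<^esub> y \<otimes>\<^bsub>A\<^esub> inv\<^bsub>A\<^esub> x)
        (\<lambda>x y. x \<otimes>\<^bsub>B\<^esub> y \<otimes>\<^bsub>B\<^esub> inv\<^bsub>B\<^esub> x)"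
      by (intro rack_pairing.intro rack_pairing_axioms.intro A.rack_conjugation star
          A.hom_conjugation[OF conjugation_hom])
  qed
qed

end
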